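(* Let $\Omega\subseteq\mathbf{R}^m$ be a domain, let $\mathbf{w}:\Omega\to(0,\infty)$ be an everywhere positive and continuous function, and let $d_{\mathbf{w}}(\zeta,\eta)$ be the $\mathbf{w}$-distance in $\Omega$. Then $$\sup_{\zeta\in\Omega}\mathbf{w}(\zeta)\|Df(\zeta)\|=\sup_{\zeta,\eta\in\Omega,\ \zeta\ne\eta}\frac{|f(\zeta)-f(\eta)|}{d_{\mathbf{w}}(\zeta,\eta)}$$ for any continuously differentiable mapping $f:\Omega\rightarrow\mathbf{R}^n$.
   Context: $|\cdot|$ is the Euclidean norm. A domain is a nonempty connected open set. $\|Df(\zeta)\|=\sup_{|\ell|=1}|Df(\zeta)\ell|$ is the operator norm of the differential $Df(\zeta):\mathbf{R}^m\to\mathbf{R}^n$. The $\mathbf{w}$-distance is $$d_{\mathbf{w}}(\zeta,\eta)=\inf_\gamma\int_\gamma\frac{|d\omega|}{\mathbf{w}(\omega)},$$ where the infimum is over all piecewise smooth curves $\gamma\subseteq\Omega$ connecting $\zeta$ and $\eta$ (and $|d\omega|$ denotes arc length); it is a distance function on $\Omega$. The suprema are taken in $[0,\infty]$ (so one side is finite if and only if the other is). *)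

theory Defs
  imports "HOL-Analysis.Analysis"
begin

(* Length of \<gamma> in the metric |d\<omega>| / w(\<omega>), with value in [0,\<infinity>]: the derivative of a valid_path
   may be unbounded near one of its finitely many exceptional points, so the integral may diverge.
   The value of the integrand at the exceptional points is unspecified but irrelevant. *)
definition weighted_length ::
  "('a::euclidean_space \<Rightarrow> real) \<Rightarrow> (real \<Rightarrow> 'a) \<Rightarrow> ennreal" where
  "weighted_length w \<gamma> =
     (\<integral>\<^sup>+ t\<in>{0..1}. ennreal (norm (vector_derivative \<gamma> (at t)) / w (\<gamma> t)) \<partial>lborel)"

(* The values are finite, and positive for \<zeta> \<noteq> \<eta>, when \<Omega> is a domain containing \<zeta> and \<eta>, and w is
   positive and continuous on \<Omega>. *)
definition w_distance ::
  "'a::euclidean_space set \<Rightarrow> ('a \<Rightarrow> real) \<Rightarrow> 'a \<Rightarrow> 'a \<Rightarrow> ennreal" where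
  "w_distance \<Omega> w \<zeta> \<eta> =
     (INF \<gamma> \<in> {\<gamma>. valid_path \<gamma> \<and> path_image \<gamma> \<subseteq> \<Omega> \<and> pathstart \<gamma> = \<zeta> \<and> pathfinish \<gamma> = \<eta>}.
        weighted_length w \<gamma>)"

end

theory Submission
  imports Defs
begin

text \<open>
  A real \<open>K \<ge> 0\<close> is an upper bound of either supremum if and only if it is one of the other;
  since both suprema lie in \<open>[0,\<infinity>]\<close>, they agree.

  If \<open>w x * norm (Df x) \<le> K\<close> throughout \<open>\<Omega>\<close>, then along a path the speed of \<open>f \<circ> \<gamma>\<close> is at most
  \<open>K\<close> times the speed of \<open>\<gamma>\<close> divided by \<open>w\<close>. Integrating, the image path joins its end points
  within length \<open>K * weighted_length w \<gamma>\<close> (\<open>path_increment_le_weighted_length\<close>), and the infimum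
  over the paths bounds the difference quotient (\<open>difference_quotient_le\<close>).

  Conversely, let \<open>f\<close> be \<open>K\<close>-Lipschitz for the \<open>w\<close>-distance and let \<open>0 < c < w x\<close>. By continuity
  \<open>w \<ge> c\<close> on a ball around \<open>x\<close>, and the straight segment shows that the \<open>w\<close>-distance from \<open>x\<close>
  to a point \<open>y\<close> of that ball is at most \<open>norm (y - x) / c\<close> (\<open>w_distance_le_segment\<close>). So \<open>f\<close>
  has Euclidean Lipschitz constant \<open>K / c\<close> at \<open>x\<close>, whence \<open>norm (Df x) \<le> K / c\<close>; then \<open>c\<close> tends
  to \<open>w x\<close> (\<open>weighted_derivative_le\<close>).
\<close>

section \<open>From the derivative to difference quotients\<close>

text \<open>
  The derivative of a piecewise smooth path may be unbounded, so the fundamental theorem of calculus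
  is applied to \<open>f \<circ> \<gamma>\<close> in its gauge-integral form, where the derivative need only exist off a
  finite set. The integrand is compared with \<open>bound\<close>, a measurable majorant: when the integral of
  \<open>bound\<close> is infinite there is nothing to prove, and otherwise it is a gauge integral too.
\<close>

lemma path_increment_le_weighted_length:
  fixes f :: "'a::euclidean_space \<Rightarrow> 'b::banach"
  assumes contw: "continuous_on \<Omega> w" and w: "\<And>x. x \<in> \<Omega> \<Longrightarrow> w x > 0"
    and der: "\<And>x. x \<in> \<Omega> \<Longrightarrow> (f has_derivative blinfun_apply (Df x)) (at x)"
    and K: "\<And>x. x \<in> \<Omega> \<Longrightarrow> w x * norm (Df x) \<le> K"
    and \<gamma>: "valid_path \<gamma>" and img: "path_image \<gamma> \<subseteq> \<Omega>"
  shows "ennreal (norm (f (pathfinish \<gamma>) - f (pathstart \<gamma>))) \<le> ennreal K * weighted_length w \<gamma>"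
proof -
  obtain S D where S: "finite S" and cont: "continuous_on {0..1} \<gamma>"
    and D: "\<And>t. t \<in> {0..1} - S \<Longrightarrow> (\<gamma> has_vector_derivative D t) (at t)"
    and contD: "continuous_on ({0..1} - S) D"
    using \<gamma> unfolding valid_path_def piecewise_C1_differentiable_on_def C1_differentiable_on_def
    by metis
  have in_\<Omega>: "\<gamma> t \<in> \<Omega>" if "t \<in> {0..1}" for t
    using img that by (auto simp: path_image_def)
  have "\<gamma> 0 \<in> \<Omega>" by (simp add: in_\<Omega>)
  then have "0 \<le> w (\<gamma> 0) * norm (Df (\<gamma> 0))"
    by (simp add: less_imp_le w)
  then have "0 \<le> K"
    using K[OF \<open>\<gamma> 0 \<in> \<Omega>\<close>] by linarith
  define speed where "speed t = indicator ({0..1} - S) t *\<^sub>R (norm (D t) / w (\<gamma> t))" for t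
  define bound where "bound t = K * speed t" for t
  have speed_nonneg: "0 \<le> speed t" for t
    using w[OF in_\<Omega>, of t] by (auto simp: speed_def indicator_def)
  then have bound_nonneg: "0 \<le> bound t" for t
    using \<open>0 \<le> K\<close> by (simp add: bound_def)
  have "continuous_on ({0..1} - S) (\<lambda>t. norm (D t) / w (\<gamma> t))"
  proof (intro continuous_intros contD)
    show "continuous_on ({0..1} - S) (\<lambda>t. w (\<gamma> t))"
      by (rule continuous_on_compose2[OF contw continuous_on_subset[OF cont]]) (auto intro: in_\<Omega>)
    show "\<forall>t\<in>{0..1} - S. w (\<gamma> t) \<noteq> 0"
      using w in_\<Omega> by fastforce
  qed
  moreover have "{0..1} - S \<in> sets borel"
    using S by (intro sets.Diff) (auto intro: finite_imp_closed borel_closed)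
  ultimately have [measurable]: "speed \<in> borel_measurable borel"
    unfolding speed_def by (rule borel_measurable_continuous_on_indicator[rotated])
  have meas: "bound \<in> borel_measurable borel"
    unfolding bound_def by measurable
  have "(\<integral>\<^sup>+ t. ennreal (speed t) \<partial>lborel) \<le> weighted_length w \<gamma>"
    unfolding weighted_length_def
  proof (rule nn_integral_mono)
    fix t
    show "ennreal (speed t)
        \<le> ennreal (norm (vector_derivative \<gamma> (at t)) / w (\<gamma> t)) * indicator {0..1} t"
      using vector_derivative_at[OF D, of t] by (auto simp: speed_def indicator_def)
  qed
  moreover have "(\<integral>\<^sup>+ t. ennreal (bound t) \<partial>lborel)
      = ennreal K * (\<integral>\<^sup>+ t. ennreal (speed t) \<partial>lborel)"
    using \<open>0 \<le> K\<close> by (simp add: bound_def ennreal_mult speed_nonneg nn_integral_cmult)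
  ultimately have le: "(\<integral>\<^sup>+ t. ennreal (bound t) \<partial>lborel) \<le> ennreal K * weighted_length w \<gamma>"
    by (simp add: mult_left_mono)
  show ?thesis
  proof (cases "(\<integral>\<^sup>+ t. ennreal (bound t) \<partial>lborel)" rule: ennreal_cases)
    case top
    with le show ?thesis by (simp add: top_unique)
  next
    case (real I)
    have "(bound has_integral I) UNIV"
      using nn_integral_has_integral[OF meas bound_nonneg] real by blast
    moreover have "(\<lambda>t. if t \<in> {0..1} then bound t else 0) = bound"
      by (auto simp: bound_def speed_def fun_eq_iff)
    ultimately have bound_int: "(bound has_integral I) {0..1}"
      using has_integral_restrict_UNIV[of "{0..1}" bound I] by simp
    \<comment> \<open>The value \<open>0\<close> at the exceptional points makes the majorization by \<open>bound\<close> hold there too.\<close>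
    define f\<gamma>' where "f\<gamma>' t = (if t \<in> S then 0 else Df (\<gamma> t) (D t))" for t
    have ftc: "(f\<gamma>' has_integral ((f \<circ> \<gamma>) 1 - (f \<circ> \<gamma>) 0)) {0..1}"
    proof (rule fundamental_theorem_of_calculus_interior_strong[OF S])
      show "((f \<circ> \<gamma>) has_vector_derivative f\<gamma>' t) (at t)" if "t \<in> {0<..<1} - S" for t
        using that vector_derivative_diff_chain_within[OF D has_derivative_at_withinI[OF der], of t]
        by (auto simp: f\<gamma>'_def in_\<Omega>)
      have "continuous_on \<Omega> f"
        by (meson continuous_at_imp_continuous_on der has_derivative_continuous)
      then show "continuous_on {0..1} (f \<circ> \<gamma>)"
        using cont in_\<Omega> by (intro continuous_on_compose) (auto elim: continuous_on_subset)
    qed simp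
    have "norm (f\<gamma>' t) \<le> bound t" if t: "t \<in> {0..1}" for t
    proof (cases "t \<in> S")
      case False
      have "norm (Df (\<gamma> t) (D t)) \<le> norm (Df (\<gamma> t)) * norm (D t)"
        by (rule norm_blinfun)
      also have "\<dots> \<le> K / w (\<gamma> t) * norm (D t)"
        using K[OF in_\<Omega>[OF t]] w[OF in_\<Omega>[OF t]]
        by (intro mult_right_mono) (auto simp: field_simps)
      finally show ?thesis
        using False t by (simp add: f\<gamma>'_def bound_def speed_def)
    qed (use bound_nonneg in \<open>simp add: f\<gamma>'_def\<close>)
    then have "norm ((f \<circ> \<gamma>) 1 - (f \<circ> \<gamma>) 0) \<le> I"
      using integral_norm_bound_integral[of f\<gamma>' "{0..1}" bound] ftc bound_int
      by (metis has_integral_integrable integral_unique)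
    then have "ennreal (norm (f (pathfinish \<gamma>) - f (pathstart \<gamma>))) \<le> ennreal I"
      by (auto simp: pathfinish_def pathstart_def intro: ennreal_leI)
    with le real show ?thesis by (metis order_trans)
  qed
qed

text \<open>
  Finiteness of \<open>b\<close> matters: for \<open>b = \<infinity>\<close> and \<open>K = 0\<close> the left side always holds, because \<open>a / \<infinity> = 0\<close>,
  whereas the right side reads \<open>a \<le> 0\<close>, because \<open>0 * \<infinity> = 0\<close>.
\<close>

lemma ennreal_divide_le_iff_le_mult:
  assumes "b < top" and "K \<ge> 0" and "a \<ge> 0"
  shows "ennreal a / b \<le> ennreal K \<longleftrightarrow> ennreal a \<le> ennreal K * b"
  using assms
  by (cases b rule: ennreal_cases; cases "b = 0")
    (auto simp: divide_ennreal field_simps top_unique simp flip: ennreal_mult)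

text \<open>
  The bound for one path passes to the infimum over all paths from \<open>x\<close> to \<open>y\<close>. The degenerate
  values of the distance cause no harm: a zero distance forces \<open>f x = f y\<close>, and \<open>0 / 0 = 0\<close>.
\<close>

lemma difference_quotient_le:
  fixes f :: "'a::euclidean_space \<Rightarrow> 'b::banach"
  assumes "continuous_on \<Omega> w" and "\<And>x. x \<in> \<Omega> \<Longrightarrow> w x > 0"
    and "\<And>x. x \<in> \<Omega> \<Longrightarrow> (f has_derivative blinfun_apply (Df x)) (at x)"
    and "\<And>x. x \<in> \<Omega> \<Longrightarrow> w x * norm (Df x) \<le> K"
  shows "ennreal (norm (f x - f y)) / w_distance \<Omega> w x y \<le> ennreal K"
proof -
  define paths where
    "paths = {\<gamma>. valid_path \<gamma> \<and> path_image \<gamma> \<subseteq> \<Omega> \<and> pathstart \<gamma> = x \<and> pathfinish \<gamma> = y}"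
  have dist: "w_distance \<Omega> w x y = (INF \<gamma>\<in>paths. weighted_length w \<gamma>)"
    by (simp add: w_distance_def paths_def)
  have bound: "ennreal (norm (f x - f y)) \<le> ennreal K * weighted_length w \<gamma>" if "\<gamma> \<in> paths" for \<gamma>
    using path_increment_le_weighted_length[OF assms, of \<gamma>] that
    by (auto simp: paths_def norm_minus_commute)
  show ?thesis
  proof (cases "paths = {}")
    \<comment> \<open>An empty infimum is \<open>\<infinity>\<close>, and the quotient by \<open>\<infinity>\<close> is \<open>0\<close>.\<close>
    case True
    then show ?thesis by (simp add: dist)
  next
    case False
    show ?thesis
    proof (cases "K > 0")
      case True
      have "ennreal (norm (f x - f y) / K) \<le> weighted_length w \<gamma>" if "\<gamma> \<in> paths" for \<gamma>
        using bound[OF that] True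
        by (cases "weighted_length w \<gamma>" rule: ennreal_cases)
          (auto simp: field_simps simp flip: ennreal_mult)
      then have "ennreal (norm (f x - f y) / K) \<le> w_distance \<Omega> w x y"
        unfolding dist by (rule INF_greatest)
      then have "ennreal (norm (f x - f y)) \<le> ennreal K * w_distance \<Omega> w x y"
        using True
        by (cases "w_distance \<Omega> w x y" rule: ennreal_cases)
          (auto simp: field_simps ennreal_mult_top simp flip: ennreal_mult)
      then show ?thesis
        using True
        by (cases "w_distance \<Omega> w x y = top")
          (auto simp: ennreal_divide_le_iff_le_mult top.not_eq_extremum)
    next
      case K: False
      with False bound show ?thesis
        by (auto simp: ennreal_neg)
    qed
  qed
qed

section \<open>From difference quotients to the derivative\<close>

lemma w_distance_le_segment:
  fixes w :: "'a::euclidean_space \<Rightarrow> real"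
  assumes sub: "closed_segment x y \<subseteq> \<Omega>" and "c > 0"
    and w: "\<And>z. z \<in> closed_segment x y \<Longrightarrow> c \<le> w z"
  shows "w_distance \<Omega> w x y \<le> ennreal (norm (y - x) / c)"
proof -
  have "w_distance \<Omega> w x y \<le> weighted_length w (linepath x y)"
    unfolding w_distance_def using sub by (intro INF_lower) auto
  also have "\<dots> \<le> (\<integral>\<^sup>+ t. ennreal (norm (y - x) / c) * indicator {0..1::real} t \<partial>lborel)"
    unfolding weighted_length_def
  proof (rule nn_integral_mono)
    fix t :: real
    have "norm (y - x) / w (linepath x y t) \<le> norm (y - x) / c" if "t \<in> {0..1}"
      using w[OF linepath_in_path[OF that]] \<open>c > 0\<close> by (simp add: frac_le)
    then show "ennreal (norm (vector_derivative (linepath x y) (at t)) / w (linepath x y t))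
          * indicator {0..1} t
        \<le> ennreal (norm (y - x) / c) * indicator {0..1} t"
      by (auto simp: indicator_def intro: ennreal_leI)
  qed
  also have "\<dots> = ennreal (norm (y - x) / c)"
    by (simp add: nn_integral_cmult_indicator)
  finally show ?thesis .
qed

text \<open>
  A Lipschitz estimate with constant \<open>M\<close> near \<open>x\<close> passes to the linear approximation up to an error
  \<open>e * norm (y - x)\<close>; by homogeneity an estimate for small vectors holds for all of them.
\<close>

lemma norm_derivative_le_local_Lipschitz:
  fixes f :: "'a::real_normed_vector \<Rightarrow> 'b::real_normed_vector"
  assumes der: "(f has_derivative blinfun_apply F) (at x)" and "M \<ge> 0"
    and lip: "\<forall>\<^sub>F y in at x. norm (f y - f x) \<le> M * norm (y - x)"
  shows "norm F \<le> M"
proof (rule field_le_epsilon)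
  fix e :: real assume "e > 0"
  then have "\<forall>\<^sub>F y in at x. norm (f y - f x - F (y - x)) \<le> e * norm (y - x)"
    using der by (auto simp: has_derivative_within_alt2)
  with lip have "\<forall>\<^sub>F y in at x. norm (F (y - x)) \<le> (M + e) * norm (y - x)"
  proof eventually_elim
    case (elim y)
    then show ?case
      using norm_triangle_ineq4[of "f y - f x" "f y - f x - F (y - x)"]
      by (simp add: algebra_simps)
  qed
  then obtain d where "d > 0"
    and d: "\<And>y. y \<noteq> x \<Longrightarrow> dist y x < d \<Longrightarrow> norm (F (y - x)) \<le> (M + e) * norm (y - x)"
    by (auto simp: eventually_at)
  show "norm F \<le> M + e"
  proof (rule norm_blinfun_bound)
    show "0 \<le> M + e" using \<open>M \<ge> 0\<close> \<open>e > 0\<close> by simp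
    fix v
    show "norm (F v) \<le> (M + e) * norm v"
    proof (cases "v = 0")
      case False
      define t where "t = d / (2 * norm v)"
      have "t > 0" and "t * norm v < d"
        using False \<open>d > 0\<close> by (auto simp: t_def)
      then have "norm (F (t *\<^sub>R v)) \<le> (M + e) * norm (t *\<^sub>R v)"
        using d[of "x + t *\<^sub>R v"] False by (simp add: dist_norm)
      with \<open>t > 0\<close> show ?thesis by (simp add: blinfun.scaleR_right)
    qed simp
  qed
qed

text \<open>
  The \<open>w\<close>-distance is locally at most the Euclidean distance divided by any \<open>c < w x\<close>, so a Lipschitz
  constant \<open>K\<close> for the former gives \<open>K / c\<close> for the latter. Choosing \<open>c = z * w x\<close> turns the passage
  \<open>c \<rightarrow> w x\<close> into letting \<open>z\<close> tend to \<open>1\<close>.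
\<close>

lemma weighted_derivative_le:
  fixes f :: "'a::euclidean_space \<Rightarrow> 'b::real_normed_vector"
  assumes "open \<Omega>" and contw: "continuous_on \<Omega> w" and "x \<in> \<Omega>" and "w x > 0" and "K \<ge> 0"
    and der: "(f has_derivative blinfun_apply F) (at x)"
    and lip: "\<And>y. y \<in> \<Omega> \<Longrightarrow> y \<noteq> x \<Longrightarrow>
      ennreal (norm (f x - f y)) / w_distance \<Omega> w x y \<le> ennreal K"
  shows "w x * norm F \<le> K"
proof (rule field_le_mult_one_interval)
  fix z :: real assume z: "0 < z" "z < 1"
  define c where "c = z * w x"
  have c: "0 < c" "c < w x"
    using z \<open>w x > 0\<close> by (auto simp: c_def)
  have "open (\<Omega> \<inter> w -` {c<..})"
    using contw \<open>open \<Omega>\<close> by (intro continuous_open_preimage) auto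
  then obtain e where "e > 0" and e: "ball x e \<subseteq> \<Omega> \<inter> w -` {c<..}"
    using \<open>x \<in> \<Omega>\<close> c by (auto elim!: openE)
  have "norm (f y - f x) \<le> K / c * norm (y - x)" if y: "y \<in> ball x e" "y \<noteq> x" for y
  proof -
    have seg: "closed_segment x y \<subseteq> ball x e"
      using y \<open>e > 0\<close> by (intro closed_segment_subset) auto
    have dist: "w_distance \<Omega> w x y \<le> ennreal (norm (y - x) / c)"
      using seg e c by (intro w_distance_le_segment) fastforce+
    then have "w_distance \<Omega> w x y < top"
      using ennreal_less_top le_less_trans by blast
    moreover have "ennreal (norm (f x - f y)) / w_distance \<Omega> w x y \<le> ennreal K"
      using y e by (intro lip) auto
    ultimately have "ennreal (norm (f y - f x)) \<le> ennreal K * w_distance \<Omega> w x y"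
      using \<open>K \<ge> 0\<close> by (simp add: ennreal_divide_le_iff_le_mult norm_minus_commute)
    also have "\<dots> \<le> ennreal K * ennreal (norm (y - x) / c)"
      using dist by (rule mult_left_mono) simp
    finally show ?thesis
      using \<open>K \<ge> 0\<close> c by (simp flip: ennreal_mult)
  qed
  then have "\<forall>\<^sub>F y in at x. norm (f y - f x) \<le> K / c * norm (y - x)"
    using \<open>e > 0\<close> by (auto simp: eventually_at dist_commute intro!: exI[of _ e])
  then have "norm F \<le> K / c"
    using \<open>K \<ge> 0\<close> c by (intro norm_derivative_le_local_Lipschitz[OF der]) auto
  then show "z * (w x * norm F) \<le> K"
    using c by (simp add: c_def field_simps)
qed

section \<open>Equality of the suprema\<close>

theorem corollary3p3:
  fixes \<Omega> :: "(real ^ 'm) set"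
    and w :: "real ^ 'm \<Rightarrow> real"
    and f :: "real ^ 'm \<Rightarrow> real ^ 'n"
    and Df :: "real ^ 'm \<Rightarrow> (real ^ 'm) \<Rightarrow>\<^sub>L (real ^ 'n)"
  assumes "open \<Omega>" and "connected \<Omega>" and "\<Omega> \<noteq> {}"
    and "continuous_on \<Omega> w" and "\<And>\<zeta>. \<zeta> \<in> \<Omega> \<Longrightarrow> w \<zeta> > 0"
    and "\<And>\<zeta>. \<zeta> \<in> \<Omega> \<Longrightarrow> (f has_derivative blinfun_apply (Df \<zeta>)) (at \<zeta>)"
    and "continuous_on \<Omega> Df"
  shows "(SUP \<zeta> \<in> \<Omega>. ennreal (w \<zeta> * norm (Df \<zeta>))) =
         (SUP (\<zeta>, \<eta>) \<in> {(\<zeta>, \<eta>). \<zeta> \<in> \<Omega> \<and> \<eta> \<in> \<Omega> \<and> \<zeta> \<noteq> \<eta>}.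
            ennreal (norm (f \<zeta> - f \<eta>)) / w_distance \<Omega> w \<zeta> \<eta>)"
    (is "?L = ?R")
proof (rule antisym)
  show "?L \<le> ?R"
  proof (cases ?R rule: ennreal_cases)
    case (real K)
    have "ennreal (norm (f x - f y)) / w_distance \<Omega> w x y \<le> ennreal K"
      if "x \<in> \<Omega>" "y \<in> \<Omega>" "y \<noteq> x" for x y
      unfolding real(2)[symmetric] using that by (intro SUP_upper2[of "(x, y)"]) auto
    then have "w x * norm (Df x) \<le> K" if "x \<in> \<Omega>" for x
      using assms that real(1) by (intro weighted_derivative_le[of \<Omega>]) auto
    then show ?thesis
      using real by (auto intro!: SUP_least ennreal_leI)
  next
    case top
    show ?thesis unfolding top by (rule top_greatest)
  qed
  show "?R \<le> ?L"
  proof (cases ?L rule: ennreal_cases)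
    case (real K)
    have "w x * norm (Df x) \<le> K" if "x \<in> \<Omega>" for x
      using SUP_upper[OF that, of "\<lambda>x. ennreal (w x * norm (Df x))"] real by simp
    then have "ennreal (norm (f x - f y)) / w_distance \<Omega> w x y \<le> ennreal K" for x y
      using assms by (intro difference_quotient_le) auto
    then show ?thesis
      using real by (auto intro!: SUP_least)
  next
    case top
    show ?thesis unfolding top by (rule top_greatest)
  qed
qed

end
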